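(* Let $I=\{1,\dots,n\}$ and let $v:2^I\to\mathbb{R}$ be a characteristic function. Let $\epsilon\in\mathbb{R}$ be such that the $\epsilon$-core of $v$ is non-empty. Let $(p_t)_{t\ge 0}$ be the sequence generated by the cyclic projection algorithm described in the context. Then $p_T$ converges, as $T\to\infty$, to an imputation in the $\epsilon$-core of $v$.
   Context: A coalitional game has agents $I=\{1,\dots,n\}$ and a characteristic function $v:2^I\to\mathbb{R}$ with $v(\emptyset)=0$, normalized so that $v(I)=1$. An imputation is a vector $p\in\mathbb{R}^n$ with $p_i\ge 0$ for all $i$ and $\sum_{i=1}^n p_i=v(I)=1$, i.e. a point of the probability simplex $\Delta\subset\mathbb{R}^n$. For a coalition $C\subseteq I$ let $c\in\{0,1\}^n$ be its indicator vector, so $p^\top c=\sum_{i\in C}p_i$. The $\epsilon$-core of $v$ is the set of imputations $p$ with $p^\top c\ge v(C)-\epsilon$ for all $C\subseteq I$. Algorithm. Let $p_0=\frac1n\mathbf{1}_n$. Fix an enumeration of the non-empty coalitions. For $t=1,2,\dots$, let $C$ be the next coalition in the enumeration, the enumeration being repeated cyclically, with indicator vector $c$; put $d_c=\max(0,\,v(C)-\epsilon-p_{t-1}^\top c)$ and $$p_t=\mathrm{Proj}_{\Delta}\Big(p_{t-1}+\frac{d_c}{|C|}\,c\Big),$$ where $\mathrm{Proj}_\Delta$ is the Euclidean projection onto $\Delta$. *)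

theory Defs
  imports "HOL-Analysis.Analysis"
begin

text \<open>
  The agents are the elements of the finite type \<open>'n\<close>, so that \<open>n = CARD('n)\<close>, coalitions are sets
  of type \<open>'n set\<close>, the grand coalition is \<open>UNIV\<close>, and \<open>real ^ 'n\<close> plays the role of
  n-dimensional space.
\<close>

definition characteristic_function :: "('n::finite set \<Rightarrow> real) \<Rightarrow> bool" where
  "characteristic_function v \<longleftrightarrow> v {} = 0 \<and> v UNIV = 1"

definition imputations :: "('n::finite set \<Rightarrow> real) \<Rightarrow> (real ^ 'n) set" where
  "imputations v = {p. (\<forall>i. 0 \<le> p $ i) \<and> (\<Sum>i\<in>UNIV. p $ i) = v UNIV}"

definition prob_simplex :: "(real ^ 'n::finite) set" where
  "prob_simplex = {p. (\<forall>i. 0 \<le> p $ i) \<and> (\<Sum>i\<in>UNIV. p $ i) = 1}"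

definition indicator_vec :: "'n::finite set \<Rightarrow> real ^ 'n" where
  "indicator_vec C = (\<chi> i. if i \<in> C then 1 else 0)"

definition eps_core :: "('n::finite set \<Rightarrow> real) \<Rightarrow> real \<Rightarrow> (real ^ 'n) set" where
  "eps_core v \<epsilon> = {p \<in> imputations v. \<forall>C. p \<bullet> indicator_vec C \<ge> v C - \<epsilon>}"

definition proj_step ::
  "('n::finite set \<Rightarrow> real) \<Rightarrow> real \<Rightarrow> 'n set \<Rightarrow> real ^ 'n \<Rightarrow> real ^ 'n" where
  "proj_step v \<epsilon> C p =
     (let c = indicator_vec C; d = max 0 (v C - \<epsilon> - p \<bullet> c)
      in closest_point prob_simplex (p + (d / real (card C)) *\<^sub>R c))"

text \<open>
  An enumeration of the non-empty coalitions is a list containing each of them exactly once.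
\<close>

definition coalition_enumeration :: "'n::finite set list \<Rightarrow> bool" where
  "coalition_enumeration Cs \<longleftrightarrow> distinct Cs \<and> set Cs = {C. C \<noteq> {}}"

text \<open>
  Lists are indexed from 0, so step \<open>t + 1\<close> of the algorithm uses the entry at position \<open>t\<close>
  modulo the length of the enumeration.
\<close>

primrec cyclic_projection ::
  "('n::finite set \<Rightarrow> real) \<Rightarrow> real \<Rightarrow> 'n set list \<Rightarrow> nat \<Rightarrow> real ^ 'n" where
  "cyclic_projection v \<epsilon> Cs 0 = (\<chi> i. 1 / real CARD('n))"
| "cyclic_projection v \<epsilon> Cs (Suc t) =
     proj_step v \<epsilon> (Cs ! (t mod length Cs)) (cyclic_projection v \<epsilon> Cs t)"

end

theory Submission
  imports Defs
begin

text \<open>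
  The correction \<open>(d / card C) *\<^sub>R c\<close> is exactly the displacement of the Euclidean projection onto
  the half space of the coalition \<open>C\<close>, so each step is a composition of two projections onto convex
  sets containing the core. Hence the iterates are Fejer monotone with respect to the core, and the
  decrease of the squared distance to a core point controls the squared violation. The violations
  and the step lengths therefore tend to zero; as every coalition reappears within one period, every
  cluster point lies in the core, and Fejer monotonicity turns a cluster point into the limit.
\<close>

text \<open>Monotonicity puts \<open>l\<close> below every term, because \<open>r k \<ge> k\<close>,
  and a single term \<open>a (r k)\<close> within \<open>e\<close> of \<open>l\<close> caps all
  later ones.\<close>

lemma decseq_tendsto_of_subseq:
  fixes a :: "nat \<Rightarrow> real"
  assumes "decseq a" "strict_mono r" "(a \<circ> r) \<longlonglongrightarrow> l"
  shows "a \<longlonglongrightarrow> l"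
proof (rule LIMSEQ_I)
  fix e :: real assume "e > 0"
  have lower: "l \<le> a n" for n
  proof (rule LIMSEQ_le_const2[OF assms(3)], intro exI[of _ n] allI impI)
    fix k assume "n \<le> k"
    then show "(a \<circ> r) k \<le> a n"
      using assms(1) seq_suble[OF assms(2), of k] by (auto simp: decseq_def)
  qed
  obtain k where k: "norm ((a \<circ> r) k - l) < e"
    using LIMSEQ_D[OF assms(3) \<open>e > 0\<close>] by blast
  show "\<exists>N. \<forall>n\<ge>N. norm (a n - l) < e"
  proof (intro exI[of _ "r k"] allI impI)
    fix n assume "r k \<le> n"
    then have "a n \<le> a (r k)" using assms(1) by (simp add: decseq_def)
    with lower[of n] k show "norm (a n - l) < e" by (simp add: abs_if split: if_splits)
  qed
qed

text \<open>The distance to one point of \<open>S\<close> bounds the orbit, so there is a cluster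
  point \<open>p\<close>. As \<open>p\<close> itself lies in \<open>S\<close>, the distances to
  \<open>p\<close> are decreasing and vanish along a subsequence, hence along the whole
  sequence.\<close>

lemma Fejer_monotone_convergent:
  fixes x :: "nat \<Rightarrow> 'a::heine_borel"
  assumes "S \<noteq> {}"
    and fejer: "\<And>q t. q \<in> S \<Longrightarrow> dist (x (Suc t)) q \<le> dist (x t) q"
    and cluster: "\<And>p r. strict_mono r \<Longrightarrow> (x \<circ> r) \<longlonglongrightarrow> p \<Longrightarrow> p \<in> S"
  shows "\<exists>p\<in>S. x \<longlonglongrightarrow> p"
proof -
  have dec: "decseq (\<lambda>t. dist (x t) q)" if "q \<in> S" for q
    by (rule decseq_SucI) (rule fejer[OF that])
  obtain q where q: "q \<in> S" using assms(1) by blast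
  have "x t \<in> cball q (dist (x 0) q)" for t
    using decseqD[OF dec[OF q], of 0 t] by (simp add: dist_commute)
  then obtain p r where r: "strict_mono r" "(x \<circ> r) \<longlonglongrightarrow> p"
    using compact_cball[of q "dist (x 0) q"] unfolding compact_def by metis
  then have p: "p \<in> S" by (rule cluster)
  have "((\<lambda>t. dist (x t) p) \<circ> r) \<longlonglongrightarrow> 0"
    using r(2) tendsto_dist_iff[of "x \<circ> r" p sequentially] by (simp add: comp_def)
  then have "(\<lambda>t. dist (x t) p) \<longlonglongrightarrow> 0"
    by (rule decseq_tendsto_of_subseq[OF dec[OF p] r(1)])
  then show ?thesis
    using p tendsto_dist_iff[of x p sequentially] by blast
qed

text \<open>Telescoping over a fixed number \<open>m\<close> of steps; used to compare iterates
  within one period.\<close>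

lemma tendsto_diff_shift:
  fixes x :: "nat \<Rightarrow> 'a::real_normed_vector"
  assumes "(\<lambda>t. x (Suc t) - x t) \<longlonglongrightarrow> 0"
  shows "(\<lambda>t. x (t + m) - x t) \<longlonglongrightarrow> 0"
proof (induction m)
  case (Suc m)
  have "(\<lambda>t. x (Suc (t + m)) - x (t + m)) \<longlonglongrightarrow> 0"
    using LIMSEQ_ignore_initial_segment[OF assms, of m] by simp
  from tendsto_add[OF this Suc] show ?case by simp
qed simp

lemma convex_prob_simplex: "convex prob_simplex"
  unfolding convex_def prob_simplex_def
  by (auto simp: sum.distrib sum_distrib_left[symmetric])

lemma closed_prob_simplex: "closed (prob_simplex :: (real ^ 'n::finite) set)"
proof -
  have eq: "prob_simplex = (\<Inter>i. {p :: real ^ 'n. 0 \<le> p $ i}) \<inter> {p. (\<Sum>i\<in>UNIV. p $ i) = 1}"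
    by (auto simp: prob_simplex_def)
  have "closed {p :: real ^ 'n. 0 \<le> p $ i}" for i
    by (intro closed_Collect_le continuous_intros)
  moreover have "closed {p :: real ^ 'n. (\<Sum>i\<in>UNIV. p $ i) = 1}"
    by (intro closed_Collect_eq continuous_intros)
  ultimately show ?thesis unfolding eq by (intro closed_Int closed_INT) simp_all
qed

lemma barycenter_in_prob_simplex: 
  "(\<chi> i. 1 / real CARD('n)) \<in> (prob_simplex :: (real ^ 'n::finite) set)"
  by (simp add: prob_simplex_def)

lemma prob_simplex_nonempty: "(prob_simplex :: (real ^ 'n::finite) set) \<noteq> {}"
  using barycenter_in_prob_simplex by blast

lemma inner_indicator_vec_self: "indicator_vec C \<bullet> indicator_vec C = real (card C)"
  by (simp add: indicator_vec_def inner_vec_def if_distrib sum.If_cases cong: if_cong)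

text \<open>The \<open>d_c\<close> of the algorithm; for non-empty \<open>C\<close> it is
  \<open>sqrt (card C)\<close> times the distance from \<open>p\<close> to the half space of
  \<open>C\<close>.\<close>

definition violation :: "('n::finite set \<Rightarrow> real) \<Rightarrow> real \<Rightarrow> 'n set \<Rightarrow> real ^ 'n \<Rightarrow> real" where
  "violation v \<epsilon> C p = max 0 (v C - \<epsilon> - p \<bullet> indicator_vec C)"

lemma proj_step_violation:
  "proj_step v \<epsilon> C p =
    closest_point prob_simplex (p + (violation v \<epsilon> C p / real (card C)) *\<^sub>R indicator_vec C)"
  by (simp add: proj_step_def violation_def Let_def)

lemma violation_nonneg: "0 \<le> violation v \<epsilon> C p"
  by (simp add: violation_def)

text \<open>Cauchy-Schwarz makes the violation Lipschitz in the point, so a bound at the iterate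
  where \<open>C\<close> is processed carries over to nearby iterates.\<close>

lemma violation_le_add:
  "violation v \<epsilon> C p \<le> violation v \<epsilon> C q + norm (indicator_vec C) * norm (q - p)"
proof -
  have "q \<bullet> indicator_vec C - p \<bullet> indicator_vec C = indicator_vec C \<bullet> (q - p)"
    by (simp add: inner_diff_right inner_commute)
  also have "\<dots> \<le> norm (indicator_vec C) * norm (q - p)"
    by (rule norm_cauchy_schwarz)
  finally show ?thesis
    using mult_nonneg_nonneg[OF norm_ge_zero[of "indicator_vec C"] norm_ge_zero[of "q - p"]]
    unfolding violation_def by linarith
qed

lemma proj_step_in_prob_simplex: "proj_step v \<epsilon> C p \<in> prob_simplex"
  unfolding proj_step_violation
  by (rule closest_point_in_set[OF closed_prob_simplex prob_simplex_nonempty])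

text \<open>The projection onto the simplex is nonexpansive and fixes \<open>q\<close>.\<close>

lemma dist_proj_step_le:
  assumes "q \<in> prob_simplex"
  shows "dist (proj_step v \<epsilon> C p) q
    \<le> dist (p + (violation v \<epsilon> C p / real (card C)) *\<^sub>R indicator_vec C) q"
  unfolding proj_step_violation
  using closest_point_lipschitz[OF convex_prob_simplex closed_prob_simplex prob_simplex_nonempty,
      of _ q] closest_point_self[OF assms] by metis

lemma dist_proj_step_self_le:
  assumes "p \<in> prob_simplex"
  shows "dist (proj_step v \<epsilon> C p) p
    \<le> violation v \<epsilon> C p / real (card C) * norm (indicator_vec C)"
  using dist_proj_step_le[OF assms, of v \<epsilon> C p] violation_nonneg[of v \<epsilon> C p]
  by (simp add: dist_norm)

text \<open>Projecting back onto the simplex does not increase the distance to \<open>q\<close>. In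
  the expanded square of the corrected point the cross term is at most
  \<open>- 2 * d\<^sup>2 / k\<close>, and the quadratic term is \<open>d\<^sup>2 / k\<close> since
  \<open>c \<bullet> c = k\<close>.\<close>

lemma proj_step_Fejer:
  assumes "C \<noteq> {}" "q \<in> prob_simplex" "v C - \<epsilon> \<le> q \<bullet> indicator_vec C"
  shows "(dist (proj_step v \<epsilon> C p) q)\<^sup>2 + (violation v \<epsilon> C p)\<^sup>2 / real (card C) \<le> (dist p q)\<^sup>2"
proof -
  define c where "c = indicator_vec C"
  define d where "d = violation v \<epsilon> C p"
  define k where "k = real (card C)"
  have "k > 0" using assms(1) by (simp add: k_def card_gt_0_iff)
  have d0: "d \<ge> 0" by (simp add: d_def violation_nonneg)
  have cc: "c \<bullet> c = k" by (simp add: c_def k_def inner_indicator_vec_self)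
  \<comment> \<open>A positive \<open>d\<close> means
    \<open>p \<bullet> c = v C - \<epsilon> - d\<close>, while
    \<open>q \<bullet> c \<ge> v C - \<epsilon>\<close>; the factor \<open>d\<close> also covers the
    case of a satisfied constraint.\<close>
  have "d * ((p - q) \<bullet> c) \<le> d * (- d)"
  proof (cases "d = 0")
    case False
    then have "(p - q) \<bullet> c \<le> - d"
      using assms(3) by (auto simp: d_def c_def violation_def inner_diff_left max_def)
    with d0 show ?thesis by (rule mult_left_mono[rotated])
  qed simp
  then have step: "d / k * ((p - q) \<bullet> c) \<le> - (d\<^sup>2 / k)"
    using \<open>k > 0\<close> by (simp add: divide_simps power2_eq_square)
  have "(dist (proj_step v \<epsilon> C p) q)\<^sup>2 \<le> (dist (p + (d / k) *\<^sub>R c) q)\<^sup>2"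
    using dist_proj_step_le[OF assms(2)] by (simp add: c_def d_def k_def power_mono)
  also have "\<dots> = ((p - q) + (d / k) *\<^sub>R c) \<bullet> ((p - q) + (d / k) *\<^sub>R c)"
    by (simp add: dist_norm power2_norm_eq_inner algebra_simps)
  also have "\<dots> = (dist p q)\<^sup>2 + 2 * (d / k * ((p - q) \<bullet> c)) + (d / k) * (d / k) * (c \<bullet> c)"
    unfolding inner_add_left inner_add_right dist_norm power2_norm_eq_inner
    by (simp add: inner_commute)
  also have "(d / k) * (d / k) * (c \<bullet> c) = d\<^sup>2 / k"
    using \<open>k > 0\<close> by (simp add: cc power2_eq_square)
  finally show ?thesis
    using step unfolding d_def[symmetric] k_def[symmetric] by linarith
qed

text \<open>The normalization \<open>v UNIV = 1\<close> identifies imputations with the simplex onto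
  which the algorithm projects.\<close>

lemma eps_coreD:
  assumes "characteristic_function v" "q \<in> eps_core v \<epsilon>"
  shows "q \<in> prob_simplex" "v C - \<epsilon> \<le> q \<bullet> indicator_vec C"
  using assms by (auto simp: characteristic_function_def eps_core_def imputations_def prob_simplex_def)

lemma cyclic_projection_in_prob_simplex: "cyclic_projection v \<epsilon> Cs t \<in> prob_simplex"
  by (cases t) (simp_all add: barycenter_in_prob_simplex proj_step_in_prob_simplex)

lemma exists_mod_eq_in_period:
  fixes L k t :: nat
  assumes "k < L"
  shows "\<exists>m<L. (t + m) mod L = k"
proof (cases "t mod L \<le> k")
  case True
  have "(t + (k - t mod L)) mod L = (t mod L + (k - t mod L)) mod L" by (simp add: mod_add_left_eq)
  then show ?thesis using True assms by (intro exI[of _ "k - t mod L"]) auto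
next
  case False
  \<comment> \<open>Position \<open>k\<close> has already passed in the current period, so the wait
    runs into the next one; adding \<open>L\<close> first keeps the subtraction on naturals from
    truncating.\<close>
  have "t mod L < L" using assms by simp
  have "(t + (L + k - t mod L)) mod L = (t mod L + (L + k - t mod L)) mod L"
    by (simp only: mod_add_left_eq)
  also have "\<dots> = k" using False assms \<open>t mod L < L\<close> by simp
  finally show ?thesis
    using False assms \<open>t mod L < L\<close> by (intro exI[of _ "L + k - t mod L"]) auto
qed

theorem theorem1:
  fixes v :: "'n::finite set \<Rightarrow> real" and \<epsilon> :: real and Cs :: "'n set list"
  assumes "characteristic_function v"
    and "eps_core v \<epsilon> \<noteq> {}"
    and "coalition_enumeration Cs"
  shows "\<exists>p \<in> eps_core v \<epsilon>. cyclic_projection v \<epsilon> Cs \<longlonglongrightarrow> p"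
proof -
  define x where "x = cyclic_projection v \<epsilon> Cs"
  define L where "L = length Cs"
  define C where "C t = Cs ! (t mod L)" for t
  define d where "d t = violation v \<epsilon> (C t) (x t)" for t
  \<comment> \<open>A bound on all coalition sizes, so that the gain in \<open>decrease\<close> is
    \<open>(d t)\<^sup>2\<close> over a constant independent of \<open>t\<close>.\<close>
  define N where "N = real CARD('n)"
  have Cs: "set Cs = {A. A \<noteq> {}}" using assms(3) by (simp add: coalition_enumeration_def)
  have "L > 0" using Cs by (auto simp: L_def)
  have C: "C t \<noteq> {}" for t
    using Cs \<open>L > 0\<close> nth_mem[of "t mod L" Cs] by (auto simp: C_def L_def)
  have card: "1 \<le> real (card (C t))" "real (card (C t)) \<le> N" for t
    using C[of t] card_mono[of UNIV "C t"] by (auto simp: N_def Suc_le_eq card_gt_0_iff)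
  have xSuc: "x (Suc t) = proj_step v \<epsilon> (C t) (x t)" for t
    by (simp add: x_def C_def L_def)
  have x: "x t \<in> prob_simplex" for t
    by (simp add: x_def cyclic_projection_in_prob_simplex)
  have d0: "0 \<le> d t" for t by (simp add: d_def violation_nonneg)
  have decrease: "(dist (x (Suc t)) q)\<^sup>2 + (d t)\<^sup>2 / N \<le> (dist (x t) q)\<^sup>2"
    if "q \<in> eps_core v \<epsilon>" for q t
  proof -
    have "(d t)\<^sup>2 / N \<le> (d t)\<^sup>2 / real (card (C t))"
      using card[of t] by (intro divide_left_mono) auto
    with proj_step_Fejer[of "C t" q v \<epsilon> "x t", OF C eps_coreD[OF assms(1) that]]
    show ?thesis unfolding xSuc d_def by (meson add_left_mono order_trans)
  qed
  have fejer: "dist (x (Suc t)) q \<le> dist (x t) q" if "q \<in> eps_core v \<epsilon>" for q t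
  proof (rule power2_le_imp_le)
    have "0 \<le> (d t)\<^sup>2 / N" by (simp add: N_def)
    with decrease[OF that, of t] show "(dist (x (Suc t)) q)\<^sup>2 \<le> (dist (x t) q)\<^sup>2" by linarith
  qed simp
  obtain q where q: "q \<in> eps_core v \<epsilon>" using assms(2) by blast
  \<comment> \<open>The distances to \<open>q\<close> converge, so consecutive squares differ by a
    null sequence, which by \<open>decrease\<close> dominates
    \<open>(d t)\<^sup>2 / N\<close>.\<close>
  have "d \<longlonglongrightarrow> 0"
  proof -
    have "decseq (\<lambda>t. dist (x t) q)" by (rule decseq_SucI) (rule fejer[OF q])
    then obtain l where l: "(\<lambda>t. dist (x t) q) \<longlonglongrightarrow> l"
      using decseq_convergent[of "\<lambda>t. dist (x t) q" 0] by auto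
    have lim: "(\<lambda>t. N * ((dist (x t) q)\<^sup>2 - (dist (x (Suc t)) q)\<^sup>2)) \<longlonglongrightarrow> N * (l\<^sup>2 - l\<^sup>2)"
      by (intro tendsto_intros l LIMSEQ_Suc[OF l])
    have "(\<lambda>t. (d t)\<^sup>2) \<longlonglongrightarrow> 0"
    proof (rule tendsto_sandwich[OF _ _ tendsto_const])
      show "\<forall>\<^sub>F t in sequentially. (d t)\<^sup>2 \<le> N * ((dist (x t) q)\<^sup>2 - (dist (x (Suc t)) q)\<^sup>2)"
        using decrease[OF q] by (intro always_eventually) (simp add: N_def field_simps)
    qed (use lim in simp_all)
    from tendsto_real_sqrt[OF this] show ?thesis by (simp add: d0)
  qed
  have "(\<lambda>t. x (Suc t) - x t) \<longlonglongrightarrow> 0"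
  proof (rule Lim_null_comparison)
    show "\<forall>\<^sub>F t in sequentially. norm (x (Suc t) - x t) \<le> d t"
    proof (intro always_eventually allI)
      fix t
      \<comment> \<open>Since \<open>card (C t) \<ge> 1\<close>, the correction, of length
        \<open>d t / sqrt (card (C t))\<close>, is no longer than \<open>d t\<close>.\<close>
      have "sqrt (real (card (C t))) \<le> real (card (C t))"
        using card(1)[of t] by (intro real_le_lsqrt) (auto simp: power2_eq_square)
      then have "d t / real (card (C t)) * norm (indicator_vec (C t)) \<le> d t"
        using card(1)[of t] d0[of t]
        by (simp add: norm_eq_sqrt_inner inner_indicator_vec_self divide_simps mult_left_mono)
      with dist_proj_step_self_le[OF x, of v \<epsilon> "C t" t] show "norm (x (Suc t) - x t) \<le> d t"
        by (simp add: xSuc d_def dist_norm)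
    qed
  qed fact
  then have shift: "(\<lambda>t. x (t + m) - x t) \<longlonglongrightarrow> 0" for m
    by (rule tendsto_diff_shift)
  have violation_lim: "(\<lambda>t. violation v \<epsilon> A (x t)) \<longlonglongrightarrow> 0" if "A \<noteq> {}" for A
  proof -
    \<comment> \<open>\<open>g t m\<close> bounds the violation of \<open>A\<close> at time
      \<open>t\<close> when the coalition \<open>C (t + m)\<close> is \<open>A\<close>. The right
      \<open>m < L\<close> varies with \<open>t\<close>, so all are summed: a finite sum of
      nonnegative null sequences.\<close>
    define g where "g t m = d (t + m) + norm (indicator_vec A) * norm (x (t + m) - x t)" for t m
    have "A \<in> set Cs" using Cs that by simp
    then obtain k where k: "k < L" "Cs ! k = A" unfolding L_def in_set_conv_nth by blast
    have "(\<lambda>t. \<Sum>m<L. g t m) \<longlonglongrightarrow> (\<Sum>m<L. 0 + norm (indicator_vec A) * 0)"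
      unfolding g_def
      by (intro tendsto_sum tendsto_add tendsto_mult tendsto_const tendsto_norm_zero[OF shift]
          LIMSEQ_ignore_initial_segment[OF \<open>d \<longlonglongrightarrow> 0\<close>])
    then have "(\<lambda>t. \<Sum>m<L. g t m) \<longlonglongrightarrow> 0" by simp
    moreover have "norm (violation v \<epsilon> A (x t)) \<le> (\<Sum>m<L. g t m)" for t
    proof -
      obtain m where m: "m < L" "(t + m) mod L = k"
        using exists_mod_eq_in_period[OF k(1)] by blast
      have "violation v \<epsilon> A (x t) \<le> g t m"
        using violation_le_add[of v \<epsilon> A "x t" "x (t + m)"] m(2) k(2)
        by (simp add: g_def d_def C_def)
      also have "\<dots> \<le> (\<Sum>m<L. g t m)"
        using m(1) d0 by (intro member_le_sum) (auto simp: g_def)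
      finally show ?thesis by (simp add: violation_nonneg)
    qed
    ultimately show ?thesis
      by (rule Lim_null_comparison[OF always_eventually[OF allI], rotated])
  qed
  have "\<exists>p\<in>eps_core v \<epsilon>. x \<longlonglongrightarrow> p"
  proof (rule Fejer_monotone_convergent[where x = x, OF assms(2) fejer])
    fix p r assume r: "strict_mono r" "(x \<circ> r) \<longlonglongrightarrow> p"
    have "p \<in> prob_simplex"
      using closed_sequentially[OF closed_prob_simplex _ r(2)] x by simp
    moreover have "v A - \<epsilon> \<le> p \<bullet> indicator_vec A" for A
    proof (cases "A = {}")
      case True
      have "indicator_vec ({} :: 'n set) = 0" by (simp add: indicator_vec_def vec_eq_iff)
      \<comment> \<open>The empty coalition is not enumerated; its constraint \<open>0 \<le> \<epsilon>\<close> holds as the core is non-empty.\<close>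
      with True eps_coreD(2)[OF assms(1) q, of "{}"] show ?thesis by simp
    next
      case False
      \<comment> \<open>The violation is continuous in the point, so its null limit along the
        iterates passes to the cluster point.\<close>
      have "(\<lambda>j. violation v \<epsilon> A ((x \<circ> r) j)) \<longlonglongrightarrow> violation v \<epsilon> A p"
        unfolding violation_def by (intro tendsto_intros r(2))
      moreover have "(\<lambda>j. violation v \<epsilon> A ((x \<circ> r) j)) \<longlonglongrightarrow> 0"
        using LIMSEQ_subseq_LIMSEQ[OF violation_lim[OF False] r(1)] by (simp add: comp_def)
      ultimately have "violation v \<epsilon> A p = 0" by (rule LIMSEQ_unique)
      then show ?thesis by (simp add: violation_def max_def split: if_splits)
    qed
    ultimately show "p \<in> eps_core v \<epsilon>"
      using assms(1)
      by (simp add: eps_core_def imputations_def prob_simplex_def characteristic_function_def)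
  qed
  then show ?thesis by (simp add: x_def)
qed

end
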